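(* There exist a positive invertible matrix $A \in M_6(\mathbb{C})$ and a normal invertible matrix $B \in M_6(\mathbb{C})$ such that $$\|A \sharp (B^{*}A^{-1}B)\| < \|B\|.$$ In other words, the assertion "for any positive invertible matrix $A$ and any normal invertible matrix $B$ in $M_n(\mathbb{C})$ one has $\|A\sharp(B^{*}A^{-1}B)\|\ge\|B\|$" is false for $n=6$.
   Context: $M_n(\mathbb{C})$ is the space of $n\times n$ complex matrices, and $\|\cdot\|$ is the operator norm. "Positive" means positive semidefinite (Hermitian), so a positive invertible matrix is a positive definite one. For positive invertible matrices $X,Y\in M_n(\mathbb{C})$, the geometric mean is $X\sharp Y = X^{1/2}(X^{-1/2}YX^{-1/2})^{1/2}X^{1/2}$. *)

theory Defs
  imports "HOL-Analysis.Analysis"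
begin

definition conj_transpose :: "complex^'n^'m \<Rightarrow> complex^'m^'n" where
  "conj_transpose A = (\<chi> i j. cnj (A $ j $ i))"

definition normal_matrix :: "complex^'n^'n \<Rightarrow> bool" where
  "normal_matrix B \<longleftrightarrow> conj_transpose B ** B = B ** conj_transpose B"

(* For Hermitian A the form x* A x is real, so taking Re loses nothing. *)
definition positive_matrix :: "complex^'n^'n \<Rightarrow> bool" where
  "positive_matrix A \<longleftrightarrow>
     conj_transpose A = A \<and>
     (\<forall>x. 0 \<le> Re (\<Sum>i\<in>UNIV. cnj (x $ i) * (A *v x) $ i))"

(* A positive matrix has exactly one positive square root; the value is
   unspecified for matrices that are not positive. *)
definition matrix_sqrt :: "complex^'n^'n \<Rightarrow> complex^'n^'n" where
  "matrix_sqrt X = (THE S. positive_matrix S \<and> S ** S = X)"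

definition geometric_mean ::
  "complex^'n^'n \<Rightarrow> complex^'n^'n \<Rightarrow> complex^'n^'n" (infixl "\<sharp>" 70) where
  "X \<sharp> Y =
     matrix_sqrt X **
     matrix_sqrt (matrix_inv (matrix_sqrt X) ** Y ** matrix_inv (matrix_sqrt X)) **
     matrix_sqrt X"

(* The norm on complex^'n is the Euclidean one, so this is the operator norm. *)
definition op_norm :: "complex^'n^'n \<Rightarrow> real" where
  "op_norm A = onorm (\<lambda>x. A *v x)"

end

theory Submission
  imports Defs
begin

text \<open>Put \<open>X = A\<inverse>\<close>. By uniqueness of positive square roots, \<open>A \<sharp> (B\<^sup>* X B)\<close> is the positive
  definite \<open>G\<close> with \<open>G X G = B\<^sup>* X B\<close>. This equation says that \<open>T = B G\<inverse>\<close> satisfies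
  \<open>T\<^sup>* X T = X\<close>, so given \<open>B\<close> and \<open>G\<close> some \<open>X\<close> exists if and only if \<open>T\<close> is similar to a unitary.
  We look for a normal \<open>B\<close> of norm 1 and a \<open>G\<close> of norm less than 1 with this property.

  View \<open>\<complex>\<^sup>6\<close> as three copies of \<open>\<complex>\<^sup>2\<close>, let \<open>G = diag(G\<^sub>0, G\<^sub>1, G\<^sub>2)\<close>, and let \<open>B\<close> move each copy to
  the next one by \<open>D = diag(1, \<i>/10)\<close>. Then \<open>T\<close> is similar to a unitary as soon as the 2 by 2
  matrix \<open>M = D G\<^sub>2\<inverse> D G\<^sub>1\<inverse> D G\<^sub>0\<inverse>\<close> is, that is, as soon as \<open>det M\<close> has modulus 1 and \<open>tr M\<close> is a
  real multiple in \<open>(-2, 2)\<close> of a square root of \<open>det M\<close>. A search over small Gaussian rationals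
  finds such \<open>G\<^sub>j\<close> with \<open>det M = -\<i>\<close>; the blocks of \<open>X\<close> come from a Hermitian form preserved by
  \<open>M\<close>.\<close>

section \<open>Positive definite matrices\<close>

definition cip :: "complex^'n \<Rightarrow> complex^'n \<Rightarrow> complex" where
  "cip x y = (\<Sum>i\<in>UNIV. cnj (x $ i) * y $ i)"

definition positive_definite :: "complex^'n^'n \<Rightarrow> bool" where
  "positive_definite A \<longleftrightarrow> conj_transpose A = A \<and> (\<forall>x. x \<noteq> 0 \<longrightarrow> 0 < Re (cip x (A *v x)))"

lemma positive_matrix_cip:
  "positive_matrix A \<longleftrightarrow> conj_transpose A = A \<and> (\<forall>x. 0 \<le> Re (cip x (A *v x)))"
  by (simp add: positive_matrix_def cip_def)

lemma cip_0_left [simp]: "cip 0 y = 0"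
  by (simp add: cip_def)

lemma cip_add_right: "cip x (y + z) = cip x y + cip x z"
  by (simp add: cip_def algebra_simps sum.distrib)

lemma cip_diff_right: "cip x (y - z) = cip x y - cip x z"
  by (simp add: cip_def algebra_simps sum_subtractf)

lemma positive_definite_imp_positive: "positive_definite A \<Longrightarrow> positive_matrix A"
  unfolding positive_definite_def positive_matrix_cip
  by (metis cip_0_left less_eq_real_def zero_complex.sel(1))

lemma positive_definite_add:
  assumes "positive_definite A" "positive_matrix B"
  shows "positive_definite (A + B)"
proof -
  have "conj_transpose (A + B) = A + B"
    using assms by (auto simp: positive_definite_def positive_matrix_cip conj_transpose_def vec_eq_iff)
  then show ?thesis
    using assms
    by (auto simp: positive_definite_def positive_matrix_cip matrix_vector_mult_add_rdistrib
        cip_add_right intro: add_pos_nonneg)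
qed

lemma cip_self: "cip x x = of_real ((norm x)\<^sup>2)"
proof -
  have "(norm x)\<^sup>2 = (\<Sum>i\<in>UNIV. (cmod (x $ i))\<^sup>2)"
    by (simp add: norm_vec_def L2_set_def sum_nonneg)
  then show ?thesis
    by (simp add: cip_def complex_norm_square mult.commute flip: of_real_power)
qed

lemma cip_axis: "cip (axis i 1) y = y $ i"
  by (simp add: cip_def axis_def if_distrib[of cnj] if_distrib[of "\<lambda>x. x * _"] cong: if_cong)

lemma cip_adjoint: "cip (A *v x) y = cip x (conj_transpose A *v y)"
proof -
  have "cip (A *v x) y = (\<Sum>i\<in>UNIV. \<Sum>j\<in>UNIV. cnj (x $ j) * (cnj (A $ i $ j) * y $ i))"
    by (simp add: cip_def matrix_vector_mult_def sum_distrib_left sum_distrib_right mult_ac)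
  also have "\<dots> = cip x (conj_transpose A *v y)"
    by (subst sum.swap) (simp add: cip_def matrix_vector_mult_def conj_transpose_def sum_distrib_left)
  finally show ?thesis .
qed

lemma matrix_vector_mult_axis: "A *v axis k 1 = column k A"
  by (simp add: vec_eq_iff matrix_vector_mult_def axis_def column_def
      if_distrib[of "\<lambda>x. _ * x"] cong: if_cong)

lemma conj_transpose_mult: "conj_transpose (A ** B) = conj_transpose B ** conj_transpose A"
  by (simp add: conj_transpose_def matrix_matrix_mult_def vec_eq_iff mult.commute)

lemma conj_transpose_conj_transpose [simp]: "conj_transpose (conj_transpose A) = A"
  by (simp add: conj_transpose_def vec_eq_iff)

lemma conj_transpose_mat_1 [simp]: "conj_transpose (mat 1) = mat 1"
  by (auto simp: conj_transpose_def vec_eq_iff mat_def)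

lemma matrix_inv_eqI:
  fixes A B :: "'a::field^'n^'n"
  assumes "A ** B = mat 1"
  shows "matrix_inv A = B"
proof -
  have BA: "B ** A = mat 1"
    using assms matrix_left_right_inverse by blast
  have "\<exists>A'. A ** A' = mat 1 \<and> A' ** A = mat 1"
    using assms BA by blast
  then have "A ** matrix_inv A = mat 1"
    unfolding matrix_inv_def by (rule someI2_ex) simp
  then show ?thesis
    by (metis BA matrix_mul_assoc matrix_mul_lid matrix_mul_rid)
qed

lemma matrix_inv_mult:
  fixes A :: "'a::field^'n^'n"
  assumes "invertible A"
  shows "A ** matrix_inv A = mat 1" "matrix_inv A ** A = mat 1"
  using assms matrix_inv_eqI unfolding invertible_def by metis+

lemma positive_definite_invertible:
  assumes "positive_definite A"
  shows "invertible A"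
proof -
  have "x = 0" if "A *v x = 0" for x
  proof (rule ccontr)
    assume "x \<noteq> 0"
    then have "0 < Re (cip x (A *v x))"
      using assms by (simp add: positive_definite_def)
    then show False
      using that by (simp add: cip_def)
  qed
  then show ?thesis
    by (meson invertible_left_inverse matrix_left_invertible_ker)
qed

lemma positive_definite_mat_1: "positive_definite (mat 1)"
  by (simp add: positive_definite_def cip_self)

lemma positive_definite_congruence:
  fixes A C :: "complex^'n^'n"
  assumes A: "positive_definite A" and C: "invertible C"
  shows "positive_definite (conj_transpose C ** A ** C)"
proof -
  have "0 < Re (cip x ((conj_transpose C ** A ** C) *v x))" if "x \<noteq> 0" for x
  proof -
    have "C *v x \<noteq> 0"
      using C that by (auto simp: invertible_left_inverse matrix_left_invertible_ker)
    then have "0 < Re (cip (C *v x) (A *v (C *v x)))"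
      using A by (simp add: positive_definite_def)
    then show ?thesis
      by (simp add: cip_adjoint matrix_vector_mul_assoc matrix_mul_assoc)
  qed
  moreover have "conj_transpose A = A"
    using A by (simp add: positive_definite_def)
  ultimately show ?thesis
    by (simp add: positive_definite_def conj_transpose_mult matrix_mul_assoc)
qed

text \<open>The inverse \<open>P\<close> is Hermitian because \<open>A\<close> is, so
  \<open>P = conj_transpose P ** A ** P\<close> is a congruence of \<open>A\<close>.\<close>

lemma positive_definite_inv:
  assumes "positive_definite A"
  shows "positive_definite (matrix_inv A)"
proof -
  let ?P = "matrix_inv A"
  have inv: "A ** ?P = mat 1" "?P ** A = mat 1"
    using assms positive_definite_invertible matrix_inv_mult by blast+
  have herm: "conj_transpose A = A"
    using assms by (simp add: positive_definite_def)
  have "A ** conj_transpose ?P = mat 1"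
    using inv(2) herm by (metis conj_transpose_mat_1 conj_transpose_mult)
  then have "conj_transpose ?P = ?P"
    by (metis matrix_inv_eqI)
  moreover have "invertible ?P"
    using inv by (auto simp: invertible_def)
  ultimately show ?thesis
    using positive_definite_congruence[OF assms, of ?P] inv by simp
qed

section \<open>Square roots and the geometric mean\<close>

text \<open>With \<open>T = S + R\<close> and \<open>D = S - R\<close>, the hypothesis gives \<open>T D = - D T\<close>, so the trace of
  \<open>D T D\<close> equals its own negative; it is also the sum of the values of the form of \<open>T\<close> at the
  columns of \<open>D\<close>.\<close>

lemma positive_square_root_unique:
  fixes S R :: "complex^'n^'n"
  assumes S: "positive_definite S" and R: "positive_matrix R" and eq: "S ** S = R ** R"
  shows "S = R"
proof -
  define T where "T = S + R"
  define D where "D = S - R"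
  have T: "positive_definite T"
    unfolding T_def by (rule positive_definite_add[OF S R])
  have D: "conj_transpose D = D"
    using S R unfolding D_def
    by (auto simp: positive_definite_def positive_matrix_cip conj_transpose_def vec_eq_iff)
  have distribs: "A ** (B - C) = A ** B - A ** C" "(B - C) ** A = B ** A - C ** A"
    "(B + C) ** A = B ** A + C ** A" for A B C :: "complex^'n^'n"
    by (simp_all add: vec_eq_iff matrix_matrix_mult_def algebra_simps sum_subtractf sum.distrib)
  have anti: "T ** D + D ** T = 0"
    unfolding T_def D_def
    by (simp add: distribs matrix_add_ldistrib eq)
  have "trace (D ** (T ** D)) + trace (D ** (D ** T)) = trace (D ** (T ** D + D ** T))"
    by (simp add: matrix_add_ldistrib trace_add)
  also have "\<dots> = 0"
    unfolding anti by (simp add: matrix_matrix_mult_def trace_def)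
  also have "trace (D ** (D ** T)) = trace (D ** (T ** D))"
    using trace_mul_sym[of D "D ** T"] by (simp add: matrix_mul_assoc)
  finally have "trace (D ** (T ** D)) = 0"
    by simp
  moreover have "trace (D ** (T ** D)) = (\<Sum>i\<in>UNIV. cip (column i D) (T *v column i D))"
  proof -
    have "(D ** (T ** D)) $ i $ i = cip (column i D) (T *v column i D)" for i
    proof -
      have "cip (column i D) (T *v column i D) = cip (D *v axis i 1) (T *v (D *v axis i 1))"
        by (simp add: matrix_vector_mult_axis)
      also have "\<dots> = cip (axis i 1) ((D ** (T ** D)) *v axis i 1)"
        by (simp add: cip_adjoint D matrix_vector_mul_assoc matrix_mul_assoc)
      also have "\<dots> = (D ** (T ** D)) $ i $ i"
        by (simp add: cip_axis matrix_vector_mult_axis column_def)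
      finally show ?thesis ..
    qed
    then show ?thesis
      by (simp add: trace_def)
  qed
  \<comment> \<open>The summands are nonnegative, so each vanishes, and definiteness of
    \<open>T\<close> forces every column of \<open>D\<close> to be zero.\<close>
  ultimately have "(\<Sum>i\<in>UNIV. Re (cip (column i D) (T *v column i D))) = 0"
    by (metis Re_sum zero_complex.sel(1))
  moreover have "0 \<le> Re (cip x (T *v x))" for x
    using positive_definite_imp_positive[OF T] by (simp add: positive_matrix_cip)
  ultimately have "Re (cip (column i D) (T *v column i D)) = 0" for i
    by (simp add: sum_nonneg_eq_0_iff)
  then have "column i D = 0" for i
    using T by (metis less_irrefl positive_definite_def)
  then show ?thesis
    by (simp add: D_def vec_eq_iff column_def)
qed

text \<open>\<open>matrix_sqrt\<close> selects among all semidefinite roots, hence the uniqueness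
  result against a merely semidefinite \<open>R\<close>.\<close>

lemma matrix_sqrt_square:
  assumes "positive_definite S"
  shows "matrix_sqrt (S ** S) = S"
  unfolding matrix_sqrt_def
proof (rule the_equality)
  show "positive_matrix S \<and> S ** S = S ** S"
    using assms by (simp add: positive_definite_imp_positive)
  show "R = S" if "positive_matrix R \<and> R ** R = S ** S" for R
    using that positive_square_root_unique[OF assms, of R] by simp
qed

text \<open>The root of \<open>matrix_inv (Q ** Q)\<close> is the inverse of \<open>Q\<close>. The
  middle factor of the mean is therefore the root of \<open>Q G Q Q G Q\<close>, the square of
  \<open>Q G Q\<close>, and the outer factors cancel both copies of \<open>Q\<close>.\<close>

lemma geometric_mean_eqI:
  assumes Q: "positive_definite Q" and G: "positive_definite G"
  shows "matrix_inv (Q ** Q) \<sharp> (G ** (Q ** Q) ** G) = G"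
proof -
  define P where "P = matrix_inv Q"
  have inv: "Q ** P = mat 1" "P ** Q = mat 1"
    unfolding P_def using Q positive_definite_invertible matrix_inv_mult by blast+
  have PQ: "P ** (Q ** Y) = Y" and QP: "Q ** (P ** Y) = Y" for Y
    by (simp_all add: matrix_mul_assoc inv)
  have "Q ** Q ** (P ** P) = mat 1"
    by (simp add: matrix_mul_assoc[symmetric] QP inv)
  then have A: "matrix_inv (Q ** Q) = P ** P"
    by (rule matrix_inv_eqI)
  have sqrtA: "matrix_sqrt (P ** P) = P"
    unfolding P_def by (rule matrix_sqrt_square[OF positive_definite_inv[OF Q]])
  have "positive_definite (Q ** G ** Q)"
    using positive_definite_congruence[OF G positive_definite_invertible[OF Q]] Q
    by (simp add: positive_definite_def)
  then have "matrix_sqrt (Q ** (G ** (Q ** Q) ** G) ** Q) = Q ** G ** Q"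
    using matrix_sqrt_square by (metis matrix_mul_assoc)
  moreover have "P ** (Q ** G ** Q) ** P = G"
    by (simp add: matrix_mul_assoc[symmetric] PQ inv)
  ultimately show ?thesis
    unfolding geometric_mean_def A sqrtA matrix_inv_eqI[OF inv(2)] by simp
qed

section \<open>Operator norm estimates\<close>

text \<open>The form of the matrix in the hypothesis at \<open>x\<close> is
  \<open>c^2 |x|^2 - |A x|^2\<close>.\<close>

lemma op_norm_le:
  fixes A :: "complex^'n^'n"
  assumes "0 \<le> c" and "positive_matrix (mat (of_real (c\<^sup>2)) - conj_transpose A ** A)"
  shows "op_norm A \<le> c"
  unfolding op_norm_def
proof (rule onorm_le)
  fix x :: "complex^'n"
  have "mat (of_real (c\<^sup>2)) *v x = (of_real (c\<^sup>2) :: complex) *s x"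
    by (simp add: vec_eq_iff matrix_vector_mult_def mat_def
        if_distrib[of "\<lambda>x. x * _"] cong: if_cong)
  then have "cip x (mat (of_real (c\<^sup>2)) *v x) = of_real (c\<^sup>2) * cip x x"
    by (simp add: cip_def sum_distrib_left mult_ac)
  moreover have "cip x (conj_transpose A ** A *v x) = cip (A *v x) (A *v x)"
    by (simp add: cip_adjoint matrix_vector_mul_assoc)
  moreover have "0 \<le> Re (cip x ((mat (of_real (c\<^sup>2)) - conj_transpose A ** A) *v x))"
    using assms(2) by (simp add: positive_matrix_cip)
  ultimately have "(norm (A *v x))\<^sup>2 \<le> c\<^sup>2 * (norm x)\<^sup>2"
    by (simp add: matrix_vector_mult_diff_rdistrib cip_diff_right cip_self
        flip: of_real_mult of_real_power)
  then show "norm (A *v x) \<le> c * norm x"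
    using assms(1) by (metis mult_nonneg_nonneg norm_ge_zero power2_le_imp_le power_mult_distrib)
qed

lemma column_norm_le_op_norm: "norm (column i A) \<le> op_norm A"
  using onorm[OF matrix_vector_mul_bounded_linear, of A "axis i 1"]
  by (simp add: op_norm_def matrix_vector_mult_axis)

section \<open>Block matrices\<close>

text \<open>Along a bijection \<open>f\<close> that labels each index by a block and a position in it, this matrix
  sends block \<open>s\<close> to block \<open>s + \<sigma>\<close> by \<open>K s\<close>.\<close>

definition block_shift ::
  "('i \<Rightarrow> 'b::ab_group_add \<times> 'c) \<Rightarrow> 'b \<Rightarrow> ('b \<Rightarrow> complex^'c^'c) \<Rightarrow> complex^'i^'i" where
  "block_shift f \<sigma> K = (\<chi> i j. if fst (f i) = fst (f j) + \<sigma>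
     then K (fst (f j)) $ snd (f i) $ snd (f j) else 0)"

lemma sum_block_reindex:
  fixes f :: "'i::finite \<Rightarrow> 'b::finite \<times> 'c::finite"
  assumes "bij f"
  shows "(\<Sum>i\<in>UNIV. g (fst (f i)) (snd (f i))) = (\<Sum>s\<in>UNIV. \<Sum>c\<in>UNIV. g s c)"
proof -
  have "(\<Sum>i\<in>UNIV. g (fst (f i)) (snd (f i))) = (\<Sum>p\<in>UNIV. g (fst p) (snd p))"
    using sum.reindex_bij_betw[OF assms, of "\<lambda>p. g (fst p) (snd p)"] by simp
  also have "\<dots> = (\<Sum>s\<in>UNIV. \<Sum>c\<in>UNIV. g s c)"
    by (simp add: sum.cartesian_product case_prod_unfold UNIV_Times_UNIV[symmetric]
        del: UNIV_Times_UNIV)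
  finally show ?thesis .
qed

context
  fixes f :: "'i::finite \<Rightarrow> 'b::{finite,ab_group_add} \<times> 'c::finite"
  assumes f: "bij f"
begin

text \<open>The right factor moves block \<open>s\<close> to \<open>s + \<tau>\<close>, and the left
  factor acts from there. Identities between large matrices thus reduce to identities between
  blocks.\<close>

lemma block_shift_mult:
  "block_shift f \<sigma> K ** block_shift f \<tau> L = block_shift f (\<sigma> + \<tau>) (\<lambda>s. K (s + \<tau>) ** L s)"
proof -
  have "(block_shift f \<sigma> K ** block_shift f \<tau> L) $ i $ k
      = block_shift f (\<sigma> + \<tau>) (\<lambda>s. K (s + \<tau>) ** L s) $ i $ k" for i k
  proof -
    have "(block_shift f \<sigma> K ** block_shift f \<tau> L) $ i $ k
      = (\<Sum>s\<in>UNIV. \<Sum>c\<in>UNIV. (if fst (f i) = s + \<sigma> then K s $ snd (f i) $ c else 0) *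
          (if s = fst (f k) + \<tau> then L (fst (f k)) $ c $ snd (f k) else 0))"
      by (subst sum_block_reindex[OF f, symmetric])
        (simp add: matrix_matrix_mult_def block_shift_def)
    also have "\<dots> = (\<Sum>s\<in>UNIV. if s = fst (f k) + \<tau> then
        (\<Sum>c\<in>UNIV. (if fst (f i) = s + \<sigma> then K s $ snd (f i) $ c else 0) *
          L (fst (f k)) $ c $ snd (f k)) else 0)"
      by (intro sum.cong) auto
    also have "\<dots> = block_shift f (\<sigma> + \<tau>) (\<lambda>s. K (s + \<tau>) ** L s) $ i $ k"
      by (auto simp: block_shift_def matrix_matrix_mult_def algebra_simps)
    finally show ?thesis .
  qed
  then show ?thesis
    by (simp add: vec_eq_iff)
qed

lemma conj_transpose_block_shift:
  "conj_transpose (block_shift f \<sigma> K) = block_shift f (- \<sigma>) (\<lambda>s. conj_transpose (K (s - \<sigma>)))"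
  by (auto simp: conj_transpose_def block_shift_def vec_eq_iff)

lemma mat_eq_block_shift: "mat a = block_shift f 0 (\<lambda>_. mat a)"
  using bij_is_inj[OF f] by (auto simp: mat_def block_shift_def vec_eq_iff prod_eq_iff inj_def)

lemma block_shift_diff:
  "block_shift f \<sigma> K - block_shift f \<sigma> L = block_shift f \<sigma> (\<lambda>s. K s - L s)"
  by (simp add: block_shift_def vec_eq_iff)

text \<open>The form is the sum of the forms of the blocks at the parts of \<open>x\<close>, and a
  nonzero \<open>x\<close> has a nonzero part.\<close>

lemma block_diagonal_positive_definite:
  assumes "\<And>s. positive_definite (K s)"
  shows "positive_definite (block_shift f 0 K)"
proof -
  define part where "part x s = (\<chi> c. x $ inv f (s, c))" for x :: "complex^'i" and s
  have part: "part x (fst (f i)) $ snd (f i) = x $ i" for x i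
    using bij_is_inj[OF f] by (simp add: part_def)
  have form: "cip x (block_shift f 0 K *v x) = (\<Sum>s\<in>UNIV. cip (part x s) (K s *v part x s))" for x
  proof -
    have app: "(block_shift f 0 K *v x) $ i = (K (fst (f i)) *v part x (fst (f i))) $ snd (f i)" for i
    proof -
      have "(block_shift f 0 K *v x) $ i = (\<Sum>j\<in>UNIV. (\<lambda>s c. (if fst (f i) = s
          then K s $ snd (f i) $ c else 0) * part x s $ c) (fst (f j)) (snd (f j)))"
        by (simp add: matrix_vector_mult_def block_shift_def part)
      also have "\<dots> = (\<Sum>s\<in>UNIV. \<Sum>c\<in>UNIV. (if fst (f i) = s
          then K s $ snd (f i) $ c else 0) * part x s $ c)"
        by (rule sum_block_reindex[OF f])
      also have "\<dots> = (\<Sum>s\<in>UNIV. if fst (f i) = s then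
          (\<Sum>c\<in>UNIV. K s $ snd (f i) $ c * part x s $ c) else 0)"
        by (intro sum.cong) auto
      finally show ?thesis
        by (simp add: matrix_vector_mult_def)
    qed
    have "cip x (block_shift f 0 K *v x) = (\<Sum>i\<in>UNIV. (\<lambda>s c. cnj (part x s $ c) *
        (K s *v part x s) $ c) (fst (f i)) (snd (f i)))"
      by (simp add: cip_def app part)
    also have "\<dots> = (\<Sum>s\<in>UNIV. \<Sum>c\<in>UNIV. cnj (part x s $ c) * (K s *v part x s) $ c)"
      by (rule sum_block_reindex[OF f])
    finally show ?thesis
      by (simp add: cip_def)
  qed
  have "0 < Re (cip x (block_shift f 0 K *v x))" if "x \<noteq> 0" for x
  proof -
    obtain i where "x $ i \<noteq> 0"
      using \<open>x \<noteq> 0\<close> by (metis vec_eq_iff zero_index)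
    then have "part x (fst (f i)) \<noteq> 0"
      by (metis part zero_index)
    then have "0 < Re (cip (part x (fst (f i))) (K (fst (f i)) *v part x (fst (f i))))"
      using assms by (simp add: positive_definite_def)
    moreover have "0 \<le> Re (cip y (K s *v y))" for s y
      using positive_definite_imp_positive[OF assms] by (simp add: positive_matrix_cip)
    ultimately show ?thesis
      unfolding form Re_sum by (intro sum_pos2[of _ "fst (f i)"]) auto
  qed
  moreover have "conj_transpose (block_shift f 0 K) = block_shift f 0 K"
    using assms by (simp add: conj_transpose_block_shift positive_definite_def)
  ultimately show ?thesis
    by (simp add: positive_definite_def)
qed

end

section \<open>Two by two matrices\<close>

definition mat2 :: "complex \<Rightarrow> complex \<Rightarrow> complex \<Rightarrow> complex \<Rightarrow> complex^2^2" where
  "mat2 a b c d = vector [vector [a, b], vector [c, d]]"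

definition herm2 :: "real \<Rightarrow> complex \<Rightarrow> real \<Rightarrow> complex^2^2" where
  "herm2 a z d = mat2 (of_real a) z (cnj z) (of_real d)"

lemma mat2_mult:
  "mat2 a b c d ** mat2 a' b' c' d' =
    mat2 (a * a' + b * c') (a * b' + b * d') (c * a' + d * c') (c * b' + d * d')"
  by (simp add: mat2_def vec_eq_iff forall_2 matrix_matrix_mult_def sum_2)

lemma conj_transpose_mat2: "conj_transpose (mat2 a b c d) = mat2 (cnj a) (cnj c) (cnj b) (cnj d)"
  by (simp add: mat2_def vec_eq_iff forall_2 conj_transpose_def)

lemma mat2_diff: "mat2 a b c d - mat2 a' b' c' d' = mat2 (a - a') (b - b') (c - c') (d - d')"
  by (simp add: mat2_def vec_eq_iff forall_2)

lemma mat_eq_mat2: "mat a = mat2 a 0 0 a"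
  by (simp add: mat2_def vec_eq_iff forall_2 mat_def)

lemma herm2_square:
  "herm2 a z d ** herm2 a z d =
    herm2 (a\<^sup>2 + (cmod z)\<^sup>2) (of_real (a + d) * z) (d\<^sup>2 + (cmod z)\<^sup>2)"
  unfolding herm2_def mat2_mult of_real_add complex_norm_square
  by (simp add: power2_eq_square algebra_simps)

lemma mat_diff_herm2: "mat (of_real c) - herm2 a z d = herm2 (c - a) (- z) (c - d)"
  by (simp add: herm2_def mat_eq_mat2 mat2_diff)

lemma herm2_positive_definite:
  assumes a: "0 < a" and det: "(cmod z)\<^sup>2 < a * d"
  shows "positive_definite (herm2 a z d)"
proof -
  have "0 < Re (cip x (herm2 a z d *v x))" if "x \<noteq> 0" for x
  proof -
    \<comment> \<open>Completing the square, after multiplication by \<open>a\<close> to avoid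
      division.\<close>
    have "a * Re (cip x (herm2 a z d *v x))
        = (cmod (a * x $ 1 + z * x $ 2))\<^sup>2 + (a * d - (cmod z)\<^sup>2) * (cmod (x $ 2))\<^sup>2"
      unfolding cmod_power2 by (simp add: herm2_def mat2_def cip_def matrix_vector_mult_def sum_2
          power2_eq_square algebra_simps)
    also have "\<dots> > 0"
    proof (cases "x $ 2 = 0")
      case True
      then have "x $ 1 \<noteq> 0"
        using that by (auto simp: vec_eq_iff forall_2)
      then show ?thesis
        using True a by simp
    next
      case False
      then show ?thesis
        using det by (intro add_nonneg_pos) auto
    qed
    finally show ?thesis
      using a by (simp add: zero_less_mult_iff)
  qed
  moreover have "conj_transpose (herm2 a z d) = herm2 a z d"
    by (simp add: herm2_def conj_transpose_mat2)
  ultimately show ?thesis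
    by (simp add: positive_definite_def)
qed

text \<open>By Cayley--Hamilton, the root of \<open>X\<close> is \<open>(X + \<delta>) / \<tau>\<close> with \<open>\<delta>\<^sup>2 = det X\<close> and
  \<open>\<tau>\<^sup>2 = tr X + 2 \<delta>\<close>.\<close>

lemma herm2_square_root:
  assumes a: "0 < a" and det: "(cmod z)\<^sup>2 < a * d"
  obtains Q where "positive_definite Q" "Q ** Q = herm2 a z d"
proof -
  define \<delta> where "\<delta> = sqrt (a * d - (cmod z)\<^sup>2)"
  define \<tau> where "\<tau> = sqrt (a + d + 2 * \<delta>)"
  have "0 < a * d"
    using det by (meson le_less_trans zero_le_power2)
  then have d: "0 < d"
    using a by (simp add: zero_less_mult_iff)
  have \<delta>: "0 < \<delta>" "\<delta>\<^sup>2 = a * d - (cmod z)\<^sup>2"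
    using det by (simp_all add: \<delta>_def)
  have \<tau>: "0 < \<tau>" "\<tau>\<^sup>2 = a + d + 2 * \<delta>"
    using a d \<delta>(1) by (simp_all add: \<tau>_def)
  define Q where "Q = herm2 ((a + \<delta>) / \<tau>) (z / of_real \<tau>) ((d + \<delta>) / \<tau>)"
  have "(cmod z)\<^sup>2 < (a + \<delta>) * (d + \<delta>)"
  proof -
    have "a * d < (a + \<delta>) * (d + \<delta>)"
      using a d \<delta>(1) by (intro mult_strict_mono) auto
    with det show ?thesis
      by linarith
  qed
  then have "(cmod (z / of_real \<tau>))\<^sup>2 < ((a + \<delta>) / \<tau>) * ((d + \<delta>) / \<tau>)"
    using \<tau>(1) by (simp add: norm_divide power_divide power2_eq_square divide_strict_right_mono)
  then have "positive_definite Q"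
    unfolding Q_def using a \<delta>(1) \<tau>(1) by (intro herm2_positive_definite) auto
  moreover have "Q ** Q = herm2 a z d"
  proof -
    have div: "(u / \<tau>)\<^sup>2 + (v / \<tau>)\<^sup>2 = w" if "u\<^sup>2 + v\<^sup>2 = w * \<tau>\<^sup>2" for u v w
      using \<tau>(1) that by (simp add: power_divide flip: add_divide_distrib)
    have sq: "(a + \<delta>)\<^sup>2 + (cmod z)\<^sup>2 = a * \<tau>\<^sup>2" "(d + \<delta>)\<^sup>2 + (cmod z)\<^sup>2 = d * \<tau>\<^sup>2"
      using \<delta>(2) unfolding \<tau>(2) by (simp_all add: power2_eq_square algebra_simps)
    \<comment> \<open>The trace of \<open>Q\<close> is \<open>\<tau>\<close>, so the off-diagonal
      entry of its square is \<open>z\<close>.\<close>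
    have tr: "(a + \<delta>) / \<tau> + (d + \<delta>) / \<tau> = \<tau>"
    proof -
      have "a + \<delta> + (d + \<delta>) = \<tau> * \<tau>"
        using \<tau>(2) by (simp add: power2_eq_square)
      then show ?thesis
        using \<tau>(1) by (simp flip: add_divide_distrib)
    qed
    show ?thesis
      unfolding Q_def herm2_square norm_divide norm_of_real abs_of_pos[OF \<tau>(1)]
        div[OF sq(1)] div[OF sq(2)] tr
      using \<tau>(1) by simp
  qed
  ultimately show thesis
    by (rule that)
qed

section \<open>The counterexample\<close>

theorem mainTheorem1:
  shows "\<exists>A B :: complex^6^6.
           positive_matrix A \<and> invertible A \<and>
           normal_matrix B \<and> invertible B \<and>
           op_norm (A \<sharp> (conj_transpose B ** matrix_inv A ** B)) < op_norm B"
proof -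
  have "CARD(6) = CARD(3 \<times> 2)"
    by simp
  then obtain f :: "6 \<Rightarrow> 3 \<times> 2" where f: "bij f"
    using finite_same_card_bij[of "UNIV :: 6 set" "UNIV :: (3 \<times> 2) set"] by auto
  define blk :: "3 \<Rightarrow> (complex^2^2) \<Rightarrow> (complex^2^2) \<Rightarrow> (complex^2^2) \<Rightarrow> (complex^2^2)" where
    "blk s K0 K1 K2 = (if s = 1 then K1 else if s = 2 then K2 else K0)" for s K0 K1 K2
  have blk_simps [simp]: "blk 1 K0 K1 K2 = K1" "blk 2 K0 K1 K2 = K2" "blk 3 K0 K1 K2 = K0"
    for K0 K1 K2
    by (simp_all add: blk_def)
  define D where "D = mat2 1 0 0 (\<i> / 10)"
  define D' where "D' = mat2 1 0 0 (- 10 * \<i>)"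
  \<comment> \<open>In the type \<open>3\<close>, block 0 is written 3.\<close>
  define X where "X s = blk s (herm2 361 (- 4332 * \<i>) 101080)
    (herm2 1444 (- 1140 + 4560 * \<i>) 16150) (herm2 400 480 1120)" for s
  \<comment> \<open>The determinants 1/38, 4/95 and 361/400 multiply to 1/1000, the cube of the
    modulus of \<open>det D\<close>, so \<open>det M\<close> has modulus 1.\<close>
  define G where "G s = blk s (herm2 (18 / 19) (- 2 / 19) (3 / 76))
    (herm2 (18 / 19) (4 / 95 - 12 / 95 * \<i>) (6 / 95)) (herm2 (19 / 20) 0 (19 / 20))" for s
  define B where "B = block_shift f 1 (\<lambda>_. D)"
  \<comment> \<open>\<open>geometric_mean_eqI\<close> needs the inverse of \<open>A\<close> as a
    square; its root is assembled from roots of the blocks.\<close>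
  have "\<exists>Q. positive_definite Q \<and> Q ** Q = X s" for s
  proof -
    have "\<forall>s. \<exists>Q. positive_definite Q \<and> Q ** Q = X s"
      unfolding forall_3 X_def blk_simps
      by (intro conjI; rule herm2_square_root; (blast | simp add: cmod_power2))
    then show ?thesis ..
  qed
  then obtain R where R: "positive_definite (R s)" "R s ** R s = X s" for s
    by metis
  define Q where "Q = block_shift f 0 R"
  define H where "H = block_shift f 0 G"
  have Q: "positive_definite Q"
    unfolding Q_def by (rule block_diagonal_positive_definite[OF f R(1)])
  have QQ: "Q ** Q = block_shift f 0 X"
    by (simp add: Q_def block_shift_mult[OF f] R(2))
  have G: "positive_definite (G s)" for s
  proof -
    have "\<forall>s. positive_definite (G s)"
      unfolding forall_3 G_def blk_simps
      by (intro conjI herm2_positive_definite;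
          (unfold cmod_power2)?; simp add: power2_eq_square)
    then show ?thesis ..
  qed
  have H: "positive_definite H"
    unfolding H_def by (rule block_diagonal_positive_definite[OF f G])
  have Bt: "conj_transpose B = block_shift f (- 1) (\<lambda>_. conj_transpose D)"
    by (simp add: B_def conj_transpose_block_shift[OF f])
  have succ: "(1 :: 3) + 1 = 2" "(2 :: 3) + 1 = 3" "(3 :: 3) + 1 = 1"
    by simp_all
  \<comment> \<open>The equation \<open>G X G = B* X B\<close>, block by block. It is linear in
    \<open>X\<close>, so a common scaling allows Gaussian integer entries. Going once around the
    cycle shows that \<open>M\<close> preserves the form of \<open>X 3\<close>.\<close>
  have "\<forall>s. G s ** X s ** G s = conj_transpose D ** X (s + 1) ** D"
    unfolding forall_3 G_def X_def D_def succ blk_simps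
    by (simp add: herm2_def mat2_mult conj_transpose_mat2 algebra_simps minus_diff_commute)
  then have key: "H ** (Q ** Q) ** H = conj_transpose B ** (Q ** Q) ** B"
    unfolding QQ Bt unfolding H_def B_def by (simp add: block_shift_mult[OF f])
  have DD: "conj_transpose D ** D = D ** conj_transpose D" "D ** D' = mat 1"
    by (simp_all add: D_def D'_def conj_transpose_mat2 mat2_mult mat_eq_mat2)
  have normal: "normal_matrix B"
    unfolding normal_matrix_def Bt by (simp add: B_def block_shift_mult[OF f] DD)
  have "B ** block_shift f (- 1) (\<lambda>_. D') = mat 1"
    by (simp add: B_def block_shift_mult[OF f] DD mat_eq_block_shift[OF f])
  then have invB: "invertible B"
    using invertible_right_inverse by blast
  \<comment> \<open>The largest eigenvalue of the blocks is about 0.967, attained by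
    \<open>G 1\<close>, which leaves room for a rational bound below 1.\<close>
  have "op_norm H \<le> 39 / 40"
  proof (rule op_norm_le)
    have "\<forall>s. positive_definite (mat (of_real ((39 / 40)\<^sup>2)) - G s ** G s)"
      unfolding forall_3 G_def blk_simps herm2_square mat_diff_herm2
      by (intro conjI herm2_positive_definite;
          (unfold cmod_power2)?; simp add: power2_eq_square)
    then have "positive_definite (mat (of_real ((39 / 40)\<^sup>2)) - H ** H)"
      using block_diagonal_positive_definite[OF f]
      by (simp add: H_def block_shift_mult[OF f] block_shift_diff[OF f]
          mat_eq_block_shift[OF f])
    then show "positive_matrix (mat (of_real ((39 / 40)\<^sup>2)) - conj_transpose H ** H)"
      using H by (simp add: positive_definite_imp_positive positive_definite_def)
  qed simp
  also have "\<dots> < 1"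
    by simp
  also have "1 \<le> op_norm B"
  proof -
    \<comment> \<open>The entry 1 of \<open>D\<close> appears in \<open>B\<close> in a column of
      block 0 and a row of block 1.\<close>
    obtain i j where "f i = (1, 1)" "f j = (0, 1)"
      using bij_is_surj[OF f] by (metis surj_def)
    then have "column j B $ i = 1"
      by (simp add: column_def B_def block_shift_def D_def mat2_def)
    then have "1 \<le> norm (column j B)"
      using Finite_Cartesian_Product.norm_nth_le[of "column j B" i] by simp
    then show ?thesis
      using column_norm_le_op_norm order_trans by blast
  qed
  finally have norms: "op_norm H < op_norm B" .
  define A where "A = matrix_inv (Q ** Q)"
  have "positive_definite (Q ** Q)"
    using positive_definite_congruence[OF positive_definite_mat_1 positive_definite_invertible[OF Q]] Q
    by (simp add: positive_definite_def)
  then have A: "positive_definite A" and "matrix_inv A = Q ** Q"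
    unfolding A_def
    using positive_definite_inv positive_definite_invertible matrix_inv_mult(2) matrix_inv_eqI
    by blast+
  then have "A \<sharp> (conj_transpose B ** matrix_inv A ** B) = H"
    unfolding A_def using geometric_mean_eqI[OF Q H] key by simp
  then show ?thesis
    using A normal invB norms positive_definite_imp_positive positive_definite_invertible by metis
qed

end
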